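(* Let $G=(V,E)$ be a locally finite simple graph and $x\in V$ an $S_1$-out regular vertex of degree $d$. If the punctured $2$-ball $\mathring B_2(x)$ has more than one connected component, then for $\mathcal N\in(0,\infty]$ $$\mathcal K_{G,x}(\mathcal N)=\begin{cases}\frac{3+d-av_1^+(x)}2-\frac{2d}{\mathcal N},&\text{if }\mathcal N\le2,\\[1mm]\frac{3-d-av_1^+(x)}2,&\text{if }\mathcal N>2.\end{cases}$$ In particular, $\mathcal K_{G,x}(\infty)=\frac{3-d-av_1^+(x)}2$, and $\mathcal K_{G,x}(\infty)<0$ except in the following four cases: (a) $d=2$, the two neighbours of $x$ are not adjacent, and $S_2(x)=\emptyset$; (c) $d=2$, the two neighbours of $x$ are not adjacent, each has exactly one neighbour in $S_2(x)$, and these two vertices of $S_2(x)$ are distinct; (d) $d=3$, no two neighbours of $x$ are adjacent, and $S_2(x)=\emptyset$; (e) $d=3$, exactly one pair of neighbours of $x$ is adjacent, and $S_2(x)=\emptyset$.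
   Context: Graphs are undirected, without loops or multiple edges, and every vertex has finite degree. For $f:V\to\mathbb R$ put $\Delta f(x)=\sum_{y\sim x}(f(y)-f(x))$ (non-normalized Laplacian), and for $f,g:V\to\mathbb R$ put $2\Gamma(f,g)=\Delta(fg)-f\Delta g-g\Delta f$, $2\Gamma_2(f,g)=\Delta\Gamma(f,g)-\Gamma(f,\Delta g)-\Gamma(\Delta f,g)$, $\Gamma(f)=\Gamma(f,f)$, $\Gamma_2(f)=\Gamma_2(f,f)$. For $\mathcal N\in(0,\infty]$ (convention $1/\infty=0$), $\mathcal K_{G,x}(\mathcal N)$ is the largest $K\in\mathbb R$ such that $\Gamma_2(f)(x)\ge\frac1{\mathcal N}(\Delta f(x))^2+K\,\Gamma(f)(x)$ for all $f:V\to\mathbb R$ (Bakry-Émery curvature function). $S_r(x)$ is the set of vertices at graph distance $r$ from $x$. For $y\in S_1(x)$, the out degree $d_y^+$ is the number of neighbours of $y$ in $S_2(x)$; $av_1^+(x)=\frac1d\sum_{y\in S_1(x)}d_y^+$. The vertex $x$ is $S_1$-out regular if all $y\in S_1(x)$ have the same out degree. $\mathring B_2(x)$ is the graph with vertex set $S_1(x)\cup S_2(x)$ whose edges are the edges of $G$ between two vertices of $S_1(x)$ and those between $S_1(x)$ and $S_2(x)$ (edges inside $S_2(x)$ are not included). *)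

theory Defs
  imports Complex_Main "HOL-Library.Extended_Real"
begin

section \<open>Locally finite simple graphs\<close>

locale locally_finite_simple_graph =
  fixes V :: "'v set" and E :: "'v set set"
  assumes edges: "e \<in> E \<Longrightarrow> \<exists>u\<in>V. \<exists>v\<in>V. u \<noteq> v \<and> e = {u, v}"
    and locally_finite: "v \<in> V \<Longrightarrow> finite {u. {v, u} \<in> E}"

definition adj :: "'v set set \<Rightarrow> 'v rel" where
  "adj E = {(u, v). {u, v} \<in> E}"

definition nbrs :: "'v set set \<Rightarrow> 'v \<Rightarrow> 'v set" where
  "nbrs E v = {u. {v, u} \<in> E}"

definition vdegree :: "'v set set \<Rightarrow> 'v \<Rightarrow> nat" where
  "vdegree E v = card (nbrs E v)"

text \<open>Least length of a walk; the infimum of the empty set is \<open>\<infinity>\<close>, so this is the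
  distance also for vertices in different components.\<close>

definition gdist :: "'v set set \<Rightarrow> 'v \<Rightarrow> 'v \<Rightarrow> enat" where
  "gdist E u v = (INF n\<in>{n. (u, v) \<in> adj E ^^ n}. enat n)"

definition gsphere :: "'v set set \<Rightarrow> nat \<Rightarrow> 'v \<Rightarrow> 'v set" where
  "gsphere E r x = {y. gdist E x y = enat r}"

definition graph_components :: "'v set \<Rightarrow> 'v set set \<Rightarrow> 'v set set" where
  "graph_components W F = W // {(u, v) \<in> W \<times> W. (u, v) \<in> (adj F)\<^sup>*}"


section \<open>Bakry-Emery curvature\<close>

text \<open>Functions on the vertex set are represented by functions on the whole vertex type:
  the operators below, evaluated at a vertex, only involve values at vertices.\<close>

definition Lap :: "'v set set \<Rightarrow> ('v \<Rightarrow> real) \<Rightarrow> 'v \<Rightarrow> real" where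
  "Lap E f x = (\<Sum>y\<in>nbrs E x. f y - f x)"

definition Gam :: "'v set set \<Rightarrow> ('v \<Rightarrow> real) \<Rightarrow> ('v \<Rightarrow> real) \<Rightarrow> 'v \<Rightarrow> real" where
  "Gam E f g x = (Lap E (\<lambda>y. f y * g y) x - f x * Lap E g x - g x * Lap E f x) / 2"

definition Gam2 :: "'v set set \<Rightarrow> ('v \<Rightarrow> real) \<Rightarrow> ('v \<Rightarrow> real) \<Rightarrow> 'v \<Rightarrow> real" where
  "Gam2 E f g x = (Lap E (Gam E f g) x - Gam E f (Lap E g) x - Gam E (Lap E f) g x) / 2"

text \<open>In \<^typ>\<open>ereal\<close>, \<open>1 / \<infinity> = 0\<close>.\<close>

definition CD_inequality :: "'v set set \<Rightarrow> 'v \<Rightarrow> real \<Rightarrow> ereal \<Rightarrow> bool" where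
  "CD_inequality E x K N \<longleftrightarrow>
     (\<forall>f. Gam2 E f f x \<ge> real_of_ereal (1 / N) * (Lap E f x)\<^sup>2 + K * Gam E f f x)"

definition BE_curvature :: "'v set set \<Rightarrow> 'v \<Rightarrow> ereal \<Rightarrow> real" where
  "BE_curvature E x N = (GREATEST K. CD_inequality E x K N)"


section \<open>The punctured 2-ball\<close>

definition out_degree :: "'v set set \<Rightarrow> 'v \<Rightarrow> 'v \<Rightarrow> nat" where
  "out_degree E x y = card (nbrs E y \<inter> gsphere E 2 x)"

definition av_out_degree :: "'v set set \<Rightarrow> 'v \<Rightarrow> real" where
  "av_out_degree E x = (\<Sum>y\<in>gsphere E 1 x. real (out_degree E x y)) / real (vdegree E x)"

definition S1_out_regular :: "'v set set \<Rightarrow> 'v \<Rightarrow> bool" where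
  "S1_out_regular E x \<longleftrightarrow>
     (\<forall>y\<in>gsphere E 1 x. \<forall>z\<in>gsphere E 1 x. out_degree E x y = out_degree E x z)"

definition punctured_ball2_verts :: "'v set set \<Rightarrow> 'v \<Rightarrow> 'v set" where
  "punctured_ball2_verts E x = gsphere E 1 x \<union> gsphere E 2 x"

definition punctured_ball2_edges :: "'v set set \<Rightarrow> 'v \<Rightarrow> 'v set set" where
  "punctured_ball2_edges E x =
     {e \<in> E. \<exists>u\<in>gsphere E 1 x. \<exists>v\<in>gsphere E 1 x \<union> gsphere E 2 x. e = {u, v}}"

definition punctured_ball2_components :: "'v set set \<Rightarrow> 'v \<Rightarrow> 'v set set" where
  "punctured_ball2_components E x =
     graph_components (punctured_ball2_verts E x) (punctured_ball2_edges E x)"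

end

theory Submission
  imports Defs "HOL-Analysis.Convex"
begin

text \<open>Write \<open>u y = f y - f x\<close>. Completing squares gives
  \<open>4 \<Gamma>\<^sub>2(f)(x) = (3 - d - d\<^sup>+) \<Sum> u\<^sup>2 + 2 (\<Sum> u)\<^sup>2 + Q(u)\<close>, with sums over \<open>S\<^sub>1(x)\<close> and with
  \<open>Q \<ge> 0\<close> a sum of squares of \<open>u y' - u y\<close> (edges in \<open>S\<^sub>1\<close>) and of \<open>u z - 2 u y\<close>
  (edges from \<open>S\<^sub>1\<close> to \<open>S\<^sub>2\<close>). The lower curvature bounds follow from this and Cauchy-Schwarz.
  The form \<open>Q\<close> vanishes on every \<open>u\<close> that is constant on \<open>S\<^sub>1 \<inter> C\<close> and doubled on \<open>S\<^sub>2 \<inter> C\<close>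
  for each component \<open>C\<close>: constants are extremal for \<open>N \<le> 2\<close>, and for \<open>N > 2\<close>
  a second component leaves room for such a \<open>u\<close> with \<open>\<Sum> u = 0\<close>.\<close>

section \<open>Graph distance and the carre du champ form\<close>

text \<open>A nonempty set of walk lengths attains its infimum, while the empty set has infimum
  \<open>\<infinity>\<close>, which is no \<open>enat n\<close>. Membership in a sphere thus becomes
  a statement about walks.\<close>

lemma gdist_eq_enat_iff:
  "gdist E u v = enat n \<longleftrightarrow> (u, v) \<in> adj E ^^ n \<and> (\<forall>m<n. (u, v) \<notin> adj E ^^ m)"
proof
  let ?A = "{n. (u, v) \<in> adj E ^^ n}"
  assume *: "gdist E u v = enat n"
  have "?A \<noteq> {}"
  proof
    assume "?A = {}"
    with * show False unfolding gdist_def by (simp only: image_empty) (simp add: top_enat_def)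
  qed
  then have "Inf (enat ` ?A) \<in> enat ` ?A"
    using LeastI_ex[of "\<lambda>k. k \<in> enat ` ?A"] by (simp add: Inf_enat_def)
  with * have "n \<in> ?A"
    by (auto simp: gdist_def)
  moreover have "n \<le> m" if "m \<in> ?A" for m
    using * INF_lower[OF that, of enat] by (simp add: gdist_def)
  ultimately show "(u, v) \<in> adj E ^^ n \<and> (\<forall>m<n. (u, v) \<notin> adj E ^^ m)"
    by force
next
  assume *: "(u, v) \<in> adj E ^^ n \<and> (\<forall>m<n. (u, v) \<notin> adj E ^^ m)"
  show "gdist E u v = enat n"
    unfolding gdist_def
  proof (rule antisym)
    show "(INF n\<in>{n. (u, v) \<in> adj E ^^ n}. enat n) \<le> enat n"
      using * by (intro INF_lower) auto
    show "enat n \<le> (INF n\<in>{n. (u, v) \<in> adj E ^^ n}. enat n)"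
      using * by (intro INF_greatest) (auto simp: not_less[symmetric])
  qed
qed

lemma Gam_eq: "Gam E f g x = (\<Sum>y\<in>nbrs E x. (f y - f x) * (g y - g x)) / 2"
  by (simp add: Gam_def Lap_def sum_distrib_left sum_subtractf[symmetric] algebra_simps)

lemma nbrs_sym: "y \<in> nbrs E x \<longleftrightarrow> x \<in> nbrs E y"
  by (simp add: nbrs_def insert_commute)

text \<open>This is the form \<open>Q\<close>. The sums run over ordered pairs, so an edge inside
  the 1-sphere is counted twice and has total weight 4.\<close>

definition Gam2_defect :: "'v set set \<Rightarrow> 'v \<Rightarrow> ('v \<Rightarrow> real) \<Rightarrow> real" where
  "Gam2_defect E x u =
     2 * (\<Sum>y\<in>gsphere E 1 x. \<Sum>w\<in>nbrs E y \<inter> gsphere E 1 x. (u w - u y)\<^sup>2) +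
     (\<Sum>y\<in>gsphere E 1 x. \<Sum>z\<in>nbrs E y \<inter> gsphere E 2 x. (u z - 2 * u y)\<^sup>2)"

lemma Gam2_defect_nonneg: "0 \<le> Gam2_defect E x u"
  by (simp add: Gam2_defect_def sum_nonneg)

section \<open>Neighbourhoods and the spheres of radius 1 and 2\<close>

context locally_finite_simple_graph
begin

lemma finite_nbrs: "finite (nbrs E v)"
proof (cases "v \<in> V")
  case True
  then show ?thesis using locally_finite by (simp add: nbrs_def)
next
  case False
  then have "nbrs E v = {}"
    using edges by (force simp: nbrs_def doubleton_eq_iff)
  then show ?thesis by simp
qed

lemma not_in_nbrs_self: "v \<notin> nbrs E v"
  using edges[of "{v}"] by (auto simp: nbrs_def)

lemma gsphere_1: "gsphere E (Suc 0) x = nbrs E x"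
  using not_in_nbrs_self by (auto simp: gsphere_def gdist_eq_enat_iff adj_def nbrs_def)

lemma gsphere_2: "gsphere E 2 x = (\<Union>y\<in>nbrs E x. nbrs E y) - nbrs E x - {x}"
  by (auto simp: gsphere_def gdist_eq_enat_iff adj_def nbrs_def numeral_2_eq_2 less_Suc_eq)

lemma card_gsphere_1: "card (gsphere E 1 x) = vdegree E x"
  by (simp add: gsphere_1 vdegree_def)

lemma finite_gsphere_1: "finite (gsphere E 1 x)"
  by (simp add: gsphere_1 finite_nbrs)

text \<open>A neighbour of a vertex at distance 1 from \<open>x\<close> has distance 0, 1 or 2 from
  \<open>x\<close>; these three parts are disjoint.\<close>

lemma sum_nbrs_gsphere_1:
  fixes h :: "'v \<Rightarrow> real"
  assumes "y \<in> gsphere E 1 x"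
  shows "(\<Sum>w\<in>nbrs E y. h w) =
    h x + (\<Sum>w\<in>nbrs E y \<inter> gsphere E 1 x. h w) + (\<Sum>w\<in>nbrs E y \<inter> gsphere E 2 x. h w)"
proof -
  have split: "nbrs E y = insert x ((nbrs E y \<inter> gsphere E 1 x) \<union> (nbrs E y \<inter> gsphere E 2 x))"
    using assms nbrs_sym[of x E y] by (auto simp: gsphere_1 gsphere_2)
  have "(\<Sum>w\<in>nbrs E y. h w) =
      (\<Sum>w\<in>insert x ((nbrs E y \<inter> gsphere E 1 x) \<union> (nbrs E y \<inter> gsphere E 2 x)). h w)"
    using split by simp
  also have "\<dots> = h x +
      (\<Sum>w\<in>(nbrs E y \<inter> gsphere E 1 x) \<union> (nbrs E y \<inter> gsphere E 2 x). h w)"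
    using not_in_nbrs_self[of x] by (subst sum.insert) (auto simp: finite_nbrs gsphere_1 gsphere_2)
  also have "\<dots> = h x +
      ((\<Sum>w\<in>nbrs E y \<inter> gsphere E 1 x. h w) + (\<Sum>w\<in>nbrs E y \<inter> gsphere E 2 x. h w))"
    by (subst sum.union_disjoint) (auto simp: finite_nbrs gsphere_1 gsphere_2)
  finally show ?thesis by simp
qed

section \<open>Closed form of \<open>Gam2\<close> at a vertex\<close>

text \<open>Adjacency is symmetric, so \<open>y\<close> and \<open>w\<close> may be exchanged in the
  sum over ordered pairs. The average of the term \<open>- 2 * u y * (u w - u y)\<close> and its
  exchanged copy is \<open>(u w - u y)\<^sup>2\<close>.\<close>

lemma sum_edges_antisym:
  fixes u :: "'v \<Rightarrow> real"
  assumes "finite S"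
  shows "(\<Sum>y\<in>S. \<Sum>w\<in>nbrs E y \<inter> S. - 2 * u y * (u w - u y)) =
    (\<Sum>y\<in>S. \<Sum>w\<in>nbrs E y \<inter> S. (u w - u y)\<^sup>2)"
proof -
  have *: "nbrs E y \<inter> S = {w \<in> S. w \<in> nbrs E y}" for y by blast
  have swap: "(\<Sum>y\<in>S. \<Sum>w\<in>nbrs E y \<inter> S. u y * (u w - u y)) =
      (\<Sum>y\<in>S. \<Sum>w\<in>nbrs E y \<inter> S. u w * (u y - u w))"
    unfolding * by (subst sum.swap_restrict) (auto simp: assms nbrs_sym)
  have "(\<Sum>y\<in>S. \<Sum>w\<in>nbrs E y \<inter> S. - 2 * u y * (u w - u y)) =
      - (\<Sum>y\<in>S. \<Sum>w\<in>nbrs E y \<inter> S. u y * (u w - u y)) -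
        (\<Sum>y\<in>S. \<Sum>w\<in>nbrs E y \<inter> S. u y * (u w - u y))"
    by (simp add: sum_negf[symmetric] sum_subtractf[symmetric] mult.assoc)
  also have "\<dots> = - (\<Sum>y\<in>S. \<Sum>w\<in>nbrs E y \<inter> S. u y * (u w - u y)) -
        (\<Sum>y\<in>S. \<Sum>w\<in>nbrs E y \<inter> S. u w * (u y - u w))"
    by (simp only: swap)
  also have "\<dots> = (\<Sum>y\<in>S. \<Sum>w\<in>nbrs E y \<inter> S. (u w - u y)\<^sup>2)"
    by (simp add: sum_negf[symmetric] sum_subtractf[symmetric] power2_eq_square algebra_simps)
  finally show ?thesis .
qed

text \<open>The term \<open>?h y w\<close> is what a neighbour \<open>w\<close> of \<open>y\<close>
  contributes to \<open>2 * Gam E f f y - 2 * u y * Lap E f y\<close>. For \<open>w = x\<close> it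
  is \<open>3 * (u y)\<^sup>2\<close>; for \<open>w\<close> in the 2-sphere it is
  \<open>(u w - 2 * u y)\<^sup>2 - (u y)\<^sup>2\<close>, which produces the out degree; inside the
  1-sphere the mixed terms are symmetrized. The terms \<open>Gam E f f x\<close> and
  \<open>Lap E f x\<close>, summed over the 1-sphere, give the degree and the squared sum.\<close>

lemma Gam2_eq:
  fixes f :: "'v \<Rightarrow> real" and x :: 'v
  defines "u \<equiv> \<lambda>y. f y - f x"
  shows "4 * Gam2 E f f x =
    (\<Sum>y\<in>gsphere E 1 x. (3 - real (vdegree E x) - real (out_degree E x y)) * (u y)\<^sup>2) +
    2 * (\<Sum>y\<in>gsphere E 1 x. u y)\<^sup>2 + Gam2_defect E x u"
proof -
  let ?S = "gsphere E 1 x" and ?T = "gsphere E 2 x"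
  have S: "nbrs E x = ?S" by (simp add: gsphere_1)
  let ?h = "\<lambda>y w. (u w - u y)\<^sup>2 - 2 * u y * (u w - u y)"
  let ?A = "\<lambda>y. \<Sum>w\<in>nbrs E y \<inter> ?S. (u w - u y)\<^sup>2"
  let ?B = "\<lambda>y. \<Sum>w\<in>nbrs E y \<inter> ?S. - 2 * u y * (u w - u y)"
  let ?C = "\<lambda>y. \<Sum>z\<in>nbrs E y \<inter> ?T. (u z - 2 * u y)\<^sup>2"
  have "4 * Gam2 E f f x = (\<Sum>y\<in>?S. 2 * Gam E f f y - 2 * Gam E f f x
      - 2 * u y * (Lap E f y - Lap E f x))"
  proof -
    have "Gam E (Lap E f) f x = Gam E f (Lap E f) x"
      by (simp add: Gam_eq mult.commute)
    then have "4 * Gam2 E f f x = 2 * Lap E (Gam E f f) x - 4 * Gam E f (Lap E f) x"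
      by (simp add: Gam2_def)
    moreover have "Lap E (Gam E f f) x = (\<Sum>y\<in>?S. Gam E f f y - Gam E f f x)"
      by (simp add: Lap_def S)
    moreover have "2 * Gam E f (Lap E f) x = (\<Sum>y\<in>?S. u y * (Lap E f y - Lap E f x))"
      by (simp add: Gam_eq S u_def)
    ultimately have "4 * Gam2 E f f x = 2 * (\<Sum>y\<in>?S. Gam E f f y - Gam E f f x) -
        2 * (\<Sum>y\<in>?S. u y * (Lap E f y - Lap E f x))"
      by simp
    then show ?thesis
      by (simp add: sum_distrib_left sum_subtractf[symmetric] right_diff_distrib mult.assoc)
  qed
  also have "\<dots> = (\<Sum>y\<in>?S. (\<Sum>w\<in>nbrs E y. ?h y w) - (\<Sum>w\<in>?S. (u w)\<^sup>2)
      + 2 * u y * (\<Sum>w\<in>?S. u w))"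
  proof (rule sum.cong[OF refl])
    fix y
    have "2 * Gam E f f y - 2 * u y * Lap E f y = (\<Sum>w\<in>nbrs E y. ?h y w)"
    proof -
      have "2 * Gam E f f y = (\<Sum>w\<in>nbrs E y. (u w - u y)\<^sup>2)"
        by (simp add: Gam_eq u_def power2_eq_square)
      moreover have "Lap E f y = (\<Sum>w\<in>nbrs E y. u w - u y)"
        by (simp add: Lap_def u_def)
      ultimately show ?thesis
        by (simp only: sum_subtractf[of "\<lambda>w. (u w - u y)\<^sup>2"] sum_distrib_left)
    qed
    moreover have "2 * Gam E f f x = (\<Sum>w\<in>?S. (u w)\<^sup>2)"
      by (simp add: Gam_eq S u_def power2_eq_square)
    moreover have "Lap E f x = (\<Sum>w\<in>?S. u w)"
      by (simp add: Lap_def S u_def)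
    ultimately show "2 * Gam E f f y - 2 * Gam E f f x - 2 * u y * (Lap E f y - Lap E f x) =
        (\<Sum>w\<in>nbrs E y. ?h y w) - (\<Sum>w\<in>?S. (u w)\<^sup>2) + 2 * u y * (\<Sum>w\<in>?S. u w)"
      by (simp add: algebra_simps)
  qed
  also have "\<dots> = (\<Sum>y\<in>?S. (3 - real (out_degree E x y)) * (u y)\<^sup>2 + ?A y + ?B y + ?C y
      - (\<Sum>w\<in>?S. (u w)\<^sup>2) + 2 * u y * (\<Sum>w\<in>?S. u w))"
  proof (rule sum.cong[OF refl])
    fix y assume y: "y \<in> ?S"
    have "(\<Sum>z\<in>nbrs E y \<inter> ?T. ?h y z) = (\<Sum>z\<in>nbrs E y \<inter> ?T. (u z - 2 * u y)\<^sup>2 - (u y)\<^sup>2)"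
      by (rule sum.cong) (auto simp: power2_eq_square algebra_simps)
    also have "\<dots> = ?C y - real (out_degree E x y) * (u y)\<^sup>2"
      by (simp add: sum_subtractf out_degree_def)
    finally have T: "(\<Sum>z\<in>nbrs E y \<inter> ?T. ?h y z) = ?C y - real (out_degree E x y) * (u y)\<^sup>2" .
    have "(\<Sum>w\<in>nbrs E y \<inter> ?S. ?h y w) = ?A y + ?B y"
      by (simp add: sum.distrib[symmetric])
    moreover have "?h y x = 3 * (u y)\<^sup>2"
      by (simp add: u_def power2_eq_square algebra_simps)
    ultimately show "(\<Sum>w\<in>nbrs E y. ?h y w) - (\<Sum>w\<in>?S. (u w)\<^sup>2) + 2 * u y * (\<Sum>w\<in>?S. u w) =
        (3 - real (out_degree E x y)) * (u y)\<^sup>2 + ?A y + ?B y + ?C y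
        - (\<Sum>w\<in>?S. (u w)\<^sup>2) + 2 * u y * (\<Sum>w\<in>?S. u w)"
      using T by (subst sum_nbrs_gsphere_1[OF y]) (simp add: algebra_simps)
  qed
  also have "\<dots> = (\<Sum>y\<in>?S. (3 - real (out_degree E x y)) * (u y)\<^sup>2) + sum ?A ?S + sum ?B ?S
      + sum ?C ?S - real (vdegree E x) * (\<Sum>w\<in>?S. (u w)\<^sup>2) + 2 * (\<Sum>y\<in>?S. u y)\<^sup>2"
    using card_gsphere_1[of x]
    by (simp add: sum.distrib sum_subtractf sum_distrib_right[symmetric] sum_distrib_left[symmetric]
        power2_eq_square)
  \<comment> \<open>The mixed terms supply a second copy of \<open>?A\<close>, hence the factor 2 in
    \<open>Gam2_defect\<close>.\<close>
  also have "sum ?B ?S = sum ?A ?S"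
    by (rule sum_edges_antisym) (rule finite_gsphere_1)
  finally show ?thesis
    by (simp add: Gam2_defect_def left_diff_distrib sum_subtractf sum_distrib_left[symmetric])
qed

section \<open>The curvature-dimension inequality and its test functions\<close>

text \<open>Four times the difference of the two sides of the inequality is \<open>?F\<close> at
  \<open>f - f x\<close>. It depends on \<open>f\<close> only up to an additive constant, so
  functions vanishing at \<open>x\<close> suffice.\<close>

lemma CD_inequality_iff:
  assumes reg: "\<forall>y\<in>gsphere E 1 x. out_degree E x y = a"
  shows "CD_inequality E x K N \<longleftrightarrow>
    (\<forall>u. u x = 0 \<longrightarrow> 0 \<le> (3 - real (vdegree E x) - real a - 2 * K) * (\<Sum>y\<in>gsphere E 1 x. (u y)\<^sup>2)
      + (2 - 4 * real_of_ereal (1 / N)) * (\<Sum>y\<in>gsphere E 1 x. u y)\<^sup>2 + Gam2_defect E x u)"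
    (is "_ \<longleftrightarrow> (\<forall>u. u x = 0 \<longrightarrow> 0 \<le> ?F u)")
proof -
  let ?S = "gsphere E 1 x" and ?c = "real_of_ereal (1 / N)"
  have F: "4 * (Gam2 E f f x - (?c * (Lap E f x)\<^sup>2 + K * Gam E f f x)) = ?F (\<lambda>y. f y - f x)" for f
  proof -
    have G: "Gam E f f x = (\<Sum>y\<in>?S. (f y - f x)\<^sup>2) / 2"
      by (simp add: Gam_eq gsphere_1 power2_eq_square)
    have L: "Lap E f x = (\<Sum>y\<in>?S. f y - f x)"
      by (simp add: Lap_def gsphere_1)
    have "(\<Sum>y\<in>?S. (3 - real (vdegree E x) - real (out_degree E x y)) * (f y - f x)\<^sup>2) =
        (3 - real (vdegree E x) - real a) * (\<Sum>y\<in>?S. (f y - f x)\<^sup>2)"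
      using reg by (simp add: sum_distrib_left)
    note G2 = Gam2_eq[of f x, unfolded this]
    show ?thesis
      unfolding G L right_diff_distrib G2 by (simp add: left_diff_distrib distrib_left)
  qed
  have CD: "CD_inequality E x K N \<longleftrightarrow> (\<forall>f. 0 \<le> ?F (\<lambda>y. f y - f x))"
    unfolding F[symmetric] CD_inequality_def
    by (simp add: zero_le_mult_iff del: right_diff_distrib_numeral)
  show ?thesis
  proof
    assume L: "CD_inequality E x K N"
    show "\<forall>u. u x = 0 \<longrightarrow> 0 \<le> ?F u"
    proof (intro allI impI)
      fix u :: "'v \<Rightarrow> real"
      assume "u x = 0"
      with L[unfolded CD, rule_format, of u] show "0 \<le> ?F u" by simp
    qed
  next
    assume R: "\<forall>u. u x = 0 \<longrightarrow> 0 \<le> ?F u"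
    show "CD_inequality E x K N"
      unfolding CD
    proof
      fix f
      show "0 \<le> ?F (\<lambda>y. f y - f x)"
        using R[rule_format, of "\<lambda>y. f y - f x"] by simp
    qed
  qed
qed

lemma Gam2_defect_eq_0:
  assumes "\<And>y w. y \<in> gsphere E 1 x \<Longrightarrow> w \<in> nbrs E y \<inter> gsphere E 1 x \<Longrightarrow> u w = u y"
    and "\<And>y z. y \<in> gsphere E 1 x \<Longrightarrow> z \<in> nbrs E y \<inter> gsphere E 2 x \<Longrightarrow> u z = 2 * u y"
  shows "Gam2_defect E x u = 0"
  using assms by (simp add: Gam2_defect_def)

text \<open>Every vertex of the 2-sphere has a neighbour in the 1-sphere, so each component meets
  the 1-sphere. Of two different components one serves as \<open>C\<close>, and the other meets the
  1-sphere outside \<open>C\<close>.\<close>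

lemma disconnected_punctured_ball2_cut:
  assumes "\<exists>C\<in>punctured_ball2_components E x. \<exists>D\<in>punctured_ball2_components E x. C \<noteq> D"
  obtains C where "gsphere E 1 x \<inter> C \<noteq> {}" "gsphere E 1 x - C \<noteq> {}"
    "\<And>y w. y \<in> gsphere E 1 x \<Longrightarrow> w \<in> nbrs E y \<Longrightarrow> w \<in> gsphere E 1 x \<union> gsphere E 2 x \<Longrightarrow>
      w \<in> C \<longleftrightarrow> y \<in> C"
proof -
  let ?S = "gsphere E 1 x" and ?T = "gsphere E 2 x"
  let ?W = "?S \<union> ?T" and ?F = "punctured_ball2_edges E x"
  define R where "R = {(u, v) \<in> ?W \<times> ?W. (u, v) \<in> (adj ?F)\<^sup>*}"
  have sym: "sym ((adj ?F)\<^sup>*)"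
    by (intro sym_rtrancl symI) (auto simp: adj_def insert_commute)
  have equiv: "equiv ?W R"
    using sym unfolding R_def
    by (intro equivI refl_onI symI transI) (auto elim: symE intro: rtrancl_trans)
  \<comment> \<open>Only edges inside the 2-sphere are dropped, so an edge with an end in the
    1-sphere and the other end in \<open>?W\<close> survives.\<close>
  have step: "(y, w) \<in> R" if "y \<in> ?S" "w \<in> nbrs E y" "w \<in> ?W" for y w
    using that by (auto simp: R_def adj_def punctured_ball2_edges_def nbrs_def intro!: r_into_rtrancl)
  have meets: "C \<inter> ?S \<noteq> {}" if "C \<in> ?W // R" for C
  proof -
    from that obtain c where c: "c \<in> ?W" "C = R `` {c}" by (rule quotientE)
    show ?thesis
    proof (cases "c \<in> ?S")
      case True
      then show ?thesis using equiv_class_self[OF equiv c(1)] c(2) by blast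
    next
      case False
      with c obtain y where "y \<in> ?S" "c \<in> nbrs E y"
        by (auto simp: gsphere_1 gsphere_2)
      with step[of y c] c equiv show ?thesis
        by (auto simp: equiv_def dest: symD)
    qed
  qed
  from assms obtain C D where CD: "C \<in> ?W // R" "D \<in> ?W // R" "C \<noteq> D"
    by (auto simp: punctured_ball2_components_def graph_components_def punctured_ball2_verts_def R_def)
  have "C \<inter> D = {}"
    using quotient_disj[OF equiv CD(1,2)] CD(3) by blast
  show ?thesis
  proof
    show "?S \<inter> C \<noteq> {}" using meets[OF CD(1)] by blast
    show "?S - C \<noteq> {}" using meets[OF CD(2)] \<open>C \<inter> D = {}\<close> by blast
    show "w \<in> C \<longleftrightarrow> y \<in> C" if "y \<in> ?S" "w \<in> nbrs E y" "w \<in> ?W" for y w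
    proof -
      have "(y, w) \<in> R" using step that by blast
      moreover from this have "(w, y) \<in> R"
        using equiv by (auto simp: equiv_def dest: symD)
      ultimately show ?thesis
        using CD(1) equiv by (meson in_quotient_imp_closed)
    qed
  qed
qed

text \<open>A function that is constant along the edges of the punctured ball extends to one with
  vanishing defect. Only the values of \<open>g\<close> on the 1-sphere then remain in the
  inequality.\<close>

lemma CD_inequality_test_function:
  assumes reg: "\<forall>y\<in>gsphere E 1 x. out_degree E x y = a"
    and CD: "CD_inequality E x K N"
    and const: "\<And>y w. y \<in> gsphere E 1 x \<Longrightarrow> w \<in> nbrs E y \<Longrightarrow>
      w \<in> gsphere E 1 x \<union> gsphere E 2 x \<Longrightarrow> g w = g y"
  shows "0 \<le> (3 - real (vdegree E x) - real a - 2 * K) * (\<Sum>y\<in>gsphere E 1 x. (g y)\<^sup>2)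
    + (2 - 4 * real_of_ereal (1 / N)) * (\<Sum>y\<in>gsphere E 1 x. g y)\<^sup>2"
proof -
  let ?S = "gsphere E 1 x" and ?T = "gsphere E 2 x"
  \<comment> \<open>Doubling on the 2-sphere annihilates the squares
    \<open>(u z - 2 * u y)\<^sup>2\<close>; the value 0 elsewhere covers \<open>x\<close>.\<close>
  define u where "u v = (if v \<in> ?S then g v else if v \<in> ?T then 2 * g v else 0)" for v
  have "u x = 0"
    using not_in_nbrs_self by (simp add: u_def gsphere_1 gsphere_2)
  moreover have "Gam2_defect E x u = 0"
  proof (rule Gam2_defect_eq_0)
    show "u w = u y" if "y \<in> ?S" "w \<in> nbrs E y \<inter> ?S" for y w
      using that const[of y w] by (simp add: u_def)
    show "u z = 2 * u y" if "y \<in> ?S" "z \<in> nbrs E y \<inter> ?T" for y z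
    proof -
      have "z \<notin> ?S" using that by (auto simp: gsphere_1 gsphere_2)
      then show ?thesis using that const[of y z] by (simp add: u_def)
    qed
  qed
  moreover have "(\<Sum>y\<in>?S. (u y)\<^sup>2) = (\<Sum>y\<in>?S. (g y)\<^sup>2)" "(\<Sum>y\<in>?S. u y) = (\<Sum>y\<in>?S. g y)"
    by (simp_all add: u_def)
  ultimately show ?thesis
    using CD CD_inequality_iff[OF reg, where K=K and N=N] by force
qed

section \<open>Optimal constants in the two ranges of the dimension\<close>

text \<open>The coefficient \<open>2 - 4 / N\<close> of the squared sum is at most 0, so
  Cauchy-Schwarz gives the lower bound. Constants are its equality case and give the upper
  bound.\<close>

lemma BE_curvature_le_2:
  assumes reg: "\<forall>y\<in>gsphere E 1 x. out_degree E x y = a"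
    and pos: "0 < vdegree E x"
    and c: "1 / 2 \<le> real_of_ereal (1 / N)"
  shows "BE_curvature E x N =
    (3 + real (vdegree E x) - real a) / 2 - 2 * real (vdegree E x) * real_of_ereal (1 / N)"
    (is "_ = ?K")
proof -
  let ?S = "gsphere E 1 x" and ?c = "real_of_ereal (1 / N)" and ?d = "real (vdegree E x)"
  show ?thesis
    unfolding BE_curvature_def
  proof (rule Greatest_equality)
    show "CD_inequality E x ?K N"
      unfolding CD_inequality_iff[OF reg]
    proof (intro allI impI)
      fix u :: "'v \<Rightarrow> real"
      have CS: "(\<Sum>y\<in>?S. u y)\<^sup>2 \<le> ?d * (\<Sum>y\<in>?S. (u y)\<^sup>2)"
        using sum_squared_le_sum_of_squares[of u ?S] card_gsphere_1[of x]
        by (simp add: mult.commute)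
      have "0 \<le> (4 * ?c - 2) * (?d * (\<Sum>y\<in>?S. (u y)\<^sup>2) - (\<Sum>y\<in>?S. u y)\<^sup>2)"
        using c CS by (intro mult_nonneg_nonneg) auto
      then show "0 \<le> (3 - ?d - real a - 2 * ?K) * (\<Sum>y\<in>?S. (u y)\<^sup>2)
          + (2 - 4 * ?c) * (\<Sum>y\<in>?S. u y)\<^sup>2 + Gam2_defect E x u"
        using Gam2_defect_nonneg[of E x u] by (simp add: field_simps)
    qed
  next
    fix K assume K: "CD_inequality E x K N"
    \<comment> \<open>The test function is \<open>g = 1\<close>.\<close>
    have "0 \<le> (3 - ?d - real a - 2 * K) * (\<Sum>y\<in>?S. 1\<^sup>2) + (2 - 4 * ?c) * (\<Sum>y\<in>?S. 1)\<^sup>2"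
      by (rule CD_inequality_test_function[OF reg K]) auto
    then have "0 \<le> ?d * (3 - ?d - real a - 2 * K + (2 - 4 * ?c) * ?d)"
      using card_gsphere_1[of x] by (simp add: power2_eq_square algebra_simps)
    then have "0 \<le> 3 - ?d - real a - 2 * K + (2 - 4 * ?c) * ?d"
      using pos by (simp add: zero_le_mult_iff)
    then show "K \<le> ?K"
      by (simp add: algebra_simps)
  qed
qed

lemma BE_curvature_gt_2:
  assumes reg: "\<forall>y\<in>gsphere E 1 x. out_degree E x y = a"
    and disconnected:
      "\<exists>C\<in>punctured_ball2_components E x. \<exists>D\<in>punctured_ball2_components E x. C \<noteq> D"
    and c: "real_of_ereal (1 / N) \<le> 1 / 2"
  shows "BE_curvature E x N = (3 - real (vdegree E x) - real a) / 2"
    (is "_ = ?K")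
proof -
  let ?S = "gsphere E 1 x" and ?c = "real_of_ereal (1 / N)" and ?d = "real (vdegree E x)"
  show ?thesis
    unfolding BE_curvature_def
  proof (rule Greatest_equality)
    show "CD_inequality E x ?K N"
      unfolding CD_inequality_iff[OF reg]
    proof (intro allI impI)
      fix u :: "'v \<Rightarrow> real"
      have "0 \<le> (2 - 4 * ?c) * (\<Sum>y\<in>?S. u y)\<^sup>2"
        using c by (intro mult_nonneg_nonneg) auto
      moreover have "3 - ?d - real a - 2 * ?K = 0" by simp
      ultimately show "0 \<le> (3 - ?d - real a - 2 * ?K) * (\<Sum>y\<in>?S. (u y)\<^sup>2)
          + (2 - 4 * ?c) * (\<Sum>y\<in>?S. u y)\<^sup>2 + Gam2_defect E x u"
        using Gam2_defect_nonneg[of E x u] by (simp only: mult_zero_left add_0_left add_nonneg_nonneg)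
    qed
  next
    fix K assume K: "CD_inequality E x K N"
    obtain C where C: "?S \<inter> C \<noteq> {}" "?S - C \<noteq> {}"
      and closed: "\<And>y w. y \<in> ?S \<Longrightarrow> w \<in> nbrs E y \<Longrightarrow> w \<in> ?S \<union> gsphere E 2 x \<Longrightarrow>
        w \<in> C \<longleftrightarrow> y \<in> C"
      using disconnected_punctured_ball2_cut[OF disconnected] by blast
    define p where "p = real (card (?S \<inter> C))"
    define q where "q = real (card (?S - C))"
    have pq: "p > 0" "q > 0"
      using C finite_gsphere_1[of x] by (auto simp: p_def q_def card_gt_0_iff)
    define g where "g v = (if v \<in> C then q else - p)" for v
    \<comment> \<open>Used with the identity for the sum and with squaring for the sum of
      squares.\<close>
    have split: "(\<Sum>y\<in>?S. h (g y)) = p * h q + q * h (- p)" for h :: "real \<Rightarrow> real"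
    proof -
      have "(\<Sum>y\<in>?S. h (g y)) = (\<Sum>y\<in>?S \<inter> C. h (g y)) + (\<Sum>y\<in>?S - C. h (g y))"
        by (rule sum.Int_Diff) (rule finite_gsphere_1)
      then show ?thesis by (simp add: g_def p_def q_def)
    qed
    have "0 \<le> (3 - ?d - real a - 2 * K) * (\<Sum>y\<in>?S. (g y)\<^sup>2) + (2 - 4 * ?c) * (\<Sum>y\<in>?S. g y)\<^sup>2"
      by (rule CD_inequality_test_function[OF reg K]) (auto simp: g_def closed)
    moreover have "(\<Sum>y\<in>?S. g y) = 0" using split[of "\<lambda>t. t"] by simp
    moreover have "(\<Sum>y\<in>?S. (g y)\<^sup>2) > 0"
      using split[of "\<lambda>t. t\<^sup>2"] pq by (simp add: add_pos_pos)
    ultimately show "K \<le> ?K" by (simp add: zero_le_mult_iff)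
  qed
qed

end

section \<open>The curvature function and the cases of nonnegative curvature\<close>

theorem corollary9p4:
  fixes V :: "'v set" and E :: "'v set set" and x :: 'v and d :: nat
  assumes "locally_finite_simple_graph V E"
    and "x \<in> V"
    and "S1_out_regular E x"
    and "vdegree E x = d"
    and "\<exists>C\<in>punctured_ball2_components E x. \<exists>D\<in>punctured_ball2_components E x. C \<noteq> D"
  shows "(\<forall>N::ereal. 0 < N \<longrightarrow>
           BE_curvature E x N =
             (if N \<le> 2 then (3 + real d - av_out_degree E x) / 2 - 2 * real d / real_of_ereal N
              else (3 - real d - av_out_degree E x) / 2))
       \<and> BE_curvature E x \<infinity> = (3 - real d - av_out_degree E x) / 2
       \<and> (BE_curvature E x \<infinity> < 0 \<longleftrightarrow> \<not>
           ( (d = 2 \<and> (\<forall>y\<in>gsphere E 1 x. \<forall>z\<in>gsphere E 1 x. {y, z} \<notin> E) \<and> gsphere E 2 x = {})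
           \<or> (d = 2 \<and> (\<forall>y\<in>gsphere E 1 x. \<forall>z\<in>gsphere E 1 x. {y, z} \<notin> E) \<and>
                (\<exists>y\<^sub>1 y\<^sub>2 z\<^sub>1 z\<^sub>2. gsphere E 1 x = {y\<^sub>1, y\<^sub>2} \<and>
                   nbrs E y\<^sub>1 \<inter> gsphere E 2 x = {z\<^sub>1} \<and> nbrs E y\<^sub>2 \<inter> gsphere E 2 x = {z\<^sub>2} \<and> z\<^sub>1 \<noteq> z\<^sub>2))
           \<or> (d = 3 \<and> (\<forall>y\<in>gsphere E 1 x. \<forall>z\<in>gsphere E 1 x. {y, z} \<notin> E) \<and> gsphere E 2 x = {})
           \<or> (d = 3 \<and> card {e \<in> E. e \<subseteq> gsphere E 1 x} = 1 \<and> gsphere E 2 x = {})))"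
proof -
  interpret locally_finite_simple_graph V E by fact
  let ?S = "gsphere E 1 x" and ?T = "gsphere E 2 x"
  obtain C where C: "?S \<inter> C \<noteq> {}" "?S - C \<noteq> {}"
    and closed: "\<And>y w. y \<in> ?S \<Longrightarrow> w \<in> nbrs E y \<Longrightarrow> w \<in> ?S \<union> ?T \<Longrightarrow> w \<in> C \<longleftrightarrow> y \<in> C"
    using disconnected_punctured_ball2_cut[OF assms(5)] by blast
  have fin: "finite ?S" by (rule finite_gsphere_1)
  have card_S: "card ?S = d" using assms(4) card_gsphere_1 by simp
  have card_split: "d = card (?S \<inter> C) + card (?S - C)"
    using card_Int_Diff[OF fin] card_S by simp
  \<comment> \<open>Both sides of the cut being nonempty, \<open>d\<close> is at least 2.\<close>
  have pos: "0 < card (?S \<inter> C)" "0 < card (?S - C)"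
    using C fin by (simp_all add: card_gt_0_iff)
  obtain y0 where y0: "y0 \<in> ?S" using C by blast
  define a where "a = out_degree E x y0"
  have reg: "\<forall>y\<in>?S. out_degree E x y = a"
    using assms(3) y0 unfolding S1_out_regular_def a_def by blast
  have av: "av_out_degree E x = real a"
    using reg card_S assms(4) card_split pos by (simp add: av_out_degree_def)
  have curv: "BE_curvature E x N =
      (if N \<le> 2 then (3 + real d - av_out_degree E x) / 2 - 2 * real d / real_of_ereal N
       else (3 - real d - av_out_degree E x) / 2)" if "0 < N" for N :: ereal
  proof (cases N)
    case (real r)
    with that have "r > 0" by simp
    then have inv: "real_of_ereal (1 / N) = 1 / r"
      using real by (simp add: one_ereal_def)
    have le: "N \<le> 2 \<longleftrightarrow> r \<le> 2"
      using real by (metis ereal_less_eq(3) numeral_eq_ereal)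
    show ?thesis
    proof (cases "r \<le> 2")
      case True
      then have "1 / 2 \<le> real_of_ereal (1 / N)"
        unfolding inv using \<open>r > 0\<close> by (simp add: field_simps)
      then show ?thesis
        using BE_curvature_le_2[OF reg, of N] True le inv real av assms(4) card_split pos by simp
    next
      case False
      then have "real_of_ereal (1 / N) \<le> 1 / 2"
        unfolding inv by (simp add: field_simps)
      then show ?thesis
        using BE_curvature_gt_2[OF reg assms(5), of N] False le av assms(4) by simp
    qed
  next
    \<comment> \<open>Here \<open>1 / N\<close> is 0, which lies in the range of
      \<open>BE_curvature_gt_2\<close>.\<close>
    case PInf
    then show ?thesis
      using BE_curvature_gt_2[OF reg assms(5), of N] av assms(4) by simp
  qed (use that in auto)
  have inf: "BE_curvature E x \<infinity> = (3 - real d - av_out_degree E x) / 2"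
    using curv[of \<infinity>] by simp
  have neg: "BE_curvature E x \<infinity> < 0 \<longleftrightarrow> \<not> d + a \<le> 3"
    unfolding inf av by auto
  \<comment> \<open>Each vertex of the 2-sphere is counted in the out degree of some neighbour in
    the 1-sphere.\<close>
  have T_empty: "?T = {} \<longleftrightarrow> a = 0"
  proof
    assume "?T = {}"
    then show "a = 0" by (simp add: a_def out_degree_def)
  next
    assume "a = 0"
    then have "nbrs E y \<inter> ?T = {}" if "y \<in> ?S" for y
      using bspec[OF reg that] finite_nbrs[of y] by (simp add: out_degree_def)
    then show "?T = {}" by (auto simp: gsphere_1 gsphere_2)
  qed
  let ?indep = "\<forall>y\<in>?S. \<forall>z\<in>?S. {y, z} \<notin> E"
  let ?c = "\<exists>y\<^sub>1 y\<^sub>2 z\<^sub>1 z\<^sub>2. ?S = {y\<^sub>1, y\<^sub>2} \<and> nbrs E y\<^sub>1 \<inter> ?T = {z\<^sub>1} \<and> nbrs E y\<^sub>2 \<inter> ?T = {z\<^sub>2} \<and> z\<^sub>1 \<noteq> z\<^sub>2"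
  let ?F = "{e \<in> E. e \<subseteq> ?S}"
  have same_side: "y \<in> C \<longleftrightarrow> z \<in> C" if "y \<in> ?S" "z \<in> ?S" "{y, z} \<in> E" for y z
    using closed[of y z] that by (auto simp: nbrs_def)
  \<comment> \<open>With \<open>d\<close> at least 2, only three pairs \<open>(d, a)\<close> give
    nonnegative curvature; the cut then determines the adjacency in each.\<close>
  have small: "d + a \<le> 3 \<longleftrightarrow> d = 2 \<and> a = 0 \<or> d = 2 \<and> a = 1 \<or> d = 3 \<and> a = 0"
    using card_split pos by auto
  \<comment> \<open>The cut separates the two neighbours, so they are not adjacent. Their outer
    neighbours lie on different sides too, hence are distinct.\<close>
  have two: "?indep \<and> (a = 1 \<longrightarrow> ?c)" if "d = 2"
  proof -
    have "card (?S \<inter> C) = 1" "card (?S - C) = 1"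
      using that card_split pos by auto
    then obtain y1 y2 where y: "?S \<inter> C = {y1}" "?S - C = {y2}"
      by (meson card_1_singletonE)
    then have S: "?S = {y1, y2}" by blast
    have ?indep
    proof (intro ballI notI)
      fix v w assume vw: "v \<in> ?S" "w \<in> ?S" "{v, w} \<in> E"
      then have "v = w"
        using same_side[OF vw] y by (metis DiffI IntI singletonD)
      then show False using vw(3) edges[of "{v, w}"] by auto
    qed
    moreover have ?c if "a = 1"
    proof -
      have "card (nbrs E y1 \<inter> ?T) = 1" "card (nbrs E y2 \<inter> ?T) = 1"
        using reg that S by (auto simp: out_degree_def)
      then obtain z1 z2 where z: "nbrs E y1 \<inter> ?T = {z1}" "nbrs E y2 \<inter> ?T = {z2}"
        by (meson card_1_singletonE)
      have "z1 \<in> C"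
        using closed[of y1 z1] y(1) z(1) by (metis IntD1 IntD2 UnI2 singletonI)
      moreover have "z2 \<notin> C"
        using closed[of y2 z2] y(2) z(2) by (metis DiffD1 DiffD2 IntD1 IntD2 UnI2 singletonI)
      ultimately have "z1 \<noteq> z2" by blast
      with S z show ?c by iprover
    qed
    ultimately show ?thesis by blast
  qed
  have three: "?indep \<or> card ?F = 1" if "d = 3"
  proof -
    have "\<exists>B. card B = 2 \<and> ?F \<subseteq> {B}"
    proof -
      \<comment> \<open>The cut splits three neighbours as 1 + 2. An edge cannot cross it, so the
        pair \<open>B\<close> is the only possible edge.\<close>
      have "card (?S \<inter> C) = 1 \<and> card (?S - C) = 2 \<or> card (?S - C) = 1 \<and> card (?S \<inter> C) = 2"
        using that card_split pos by arith
      then obtain B D where BD: "B = ?S - C \<and> D = ?S \<inter> C \<or> B = ?S \<inter> C \<and> D = ?S - C"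
        "card D = 1" "card B = 2"
        by blast
      have "e = B" if "e \<in> ?F" for e
      proof -
        from that obtain v w where e: "e = {v, w}" "v \<noteq> w" "{v, w} \<in> E" "v \<in> ?S" "w \<in> ?S"
          using edges[of e] by auto
        then have "v \<in> C \<longleftrightarrow> w \<in> C" using same_side by blast
        then have "e \<subseteq> B \<or> e \<subseteq> D"
          using BD(1) e by (cases "v \<in> C") auto
        moreover have "card e = 2" using e by simp
        moreover have "finite B" "finite D" using BD(1) fin by auto
        then have "card e \<le> 1" if "e \<subseteq> D"
          using card_mono[OF _ that] BD(2) by simp
        ultimately show "e = B"
          using BD(3) \<open>finite B\<close> by (metis card_subset_eq numeral_le_one_iff semiring_norm(69))
      qed
      with BD(3) show ?thesis by blast
    qed
    then obtain B where B: "?F \<subseteq> {B}" by blast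
    show ?thesis
    proof (cases "?F = {}")
      case True
      then show ?thesis by blast
    next
      case False
      with B have "?F = {B}" by blast
      then show ?thesis by simp
    qed
  qed
  have one: "a = 1" if ?c
    using that reg by (auto simp: out_degree_def)
  \<comment> \<open>The graph conditions are abstracted to propositional variables, which leaves
    pure logic on top of \<open>small\<close>.\<close>
  have cases: "d + a \<le> 3 \<longleftrightarrow>
      (d = 2 \<and> indep \<and> a = 0) \<or> (d = 2 \<and> indep \<and> c) \<or> (d = 3 \<and> indep \<and> a = 0) \<or> (d = 3 \<and> F \<and> a = 0)"
    if "d = 2 \<Longrightarrow> indep \<and> (a = 1 \<longrightarrow> c)" "d = 3 \<Longrightarrow> indep \<or> F" "c \<Longrightarrow> a = 1" for indep c F
    using small that by blast
  show ?thesis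
  proof (intro conjI)
    show "\<forall>N::ereal. 0 < N \<longrightarrow> BE_curvature E x N =
        (if N \<le> 2 then (3 + real d - av_out_degree E x) / 2 - 2 * real d / real_of_ereal N
         else (3 - real d - av_out_degree E x) / 2)"
      using curv by blast
    show "BE_curvature E x \<infinity> < 0 \<longleftrightarrow> \<not>
        ((d = 2 \<and> ?indep \<and> ?T = {}) \<or> (d = 2 \<and> ?indep \<and> ?c) \<or>
         (d = 3 \<and> ?indep \<and> ?T = {}) \<or> (d = 3 \<and> card ?F = 1 \<and> ?T = {}))"
      unfolding neg T_empty by (rule arg_cong[OF cases[OF two three one]])
  qed (rule inf)
qed

end
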